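(* Let $\mathcal{P}$ be the set of integer partitions in which none of $1+1$, $1+2+3$, $2+2+3$ occurs as a sub-partition and in which, for every positive integer $i$, none of the following occurs as a sub-partition: $i+i+i$; $i+(i+1)+(i+1)$; $i+i+(i+1)+(i+2)$; $i+(i+1)+(i+2)+(i+3)$; $i+i+(i+2)+(i+2)+(i+3)$. Then, as formal power series in $x,q$, writing $M=i+2j+3k+4l$ and $L=2l^2+2i+3j+4k+6l$, $$\sum_{\pi\in\mathcal{P}}x^{\ell(\pi)}q^{|\pi|}=\sum_{i,j,k,l\ge 0}(-1)^l\,\frac{x^{M}q^{\frac{M(M-1)}{2}+L}+x^{M+1}q^{\frac{(M+1)M}{2}+L+1}+x^{M+2}q^{\frac{(M+2)(M+1)}{2}+L+2}-x^{M+3}q^{\frac{(M+3)(M+2)}{2}+L+4}}{(q;q)_i\,(q^2;q^2)_j\,(q^3;q^3)_k\,(q^4;q^4)_l}.$$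
   Context: Partitions are finite weakly increasing sequences of positive integers (the empty partition is included); $\ell(\pi)$ is the number of parts and $|\pi|$ the sum of the parts of $\pi$. A sub-partition of a partition is a contiguous portion of it. For $n\ge 0$, $(a;q)_n=\prod_{0\le t<n}(1-aq^t)$. All identities are identities of formal power series. *)

theory Defs
  imports "HOL-Computational_Algebra.Formal_Power_Series" "HOL-Library.Sublist"
begin

unbundle fps_syntax

text \<open>
  A partition is the weakly increasing list of its parts. A sub-partition is a contiguous
  portion of this list, that is, a \<^const>\<open>sublist\<close> (which is contiguous, unlike \<^const>\<open>subseq\<close>).
\<close>

definition is_partition :: "nat list \<Rightarrow> bool" where
  "is_partition \<pi> \<longleftrightarrow> sorted \<pi> \<and> (\<forall>p\<in>set \<pi>. 0 < p)"

definition forbidden :: "nat list set" where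
  "forbidden =
     {[1, 1], [1, 2, 3], [2, 2, 3]} \<union>
     (\<Union>i\<in>{1..}. {[i, i, i],
                  [i, i + 1, i + 1],
                  [i, i, i + 1, i + 2],
                  [i, i + 1, i + 2, i + 3],
                  [i, i, i + 2, i + 2, i + 3]})"

definition restricted_partitions :: "nat list set" where
  "restricted_partitions = {\<pi>. is_partition \<pi> \<and> (\<forall>\<sigma>\<in>forbidden. \<not> sublist \<sigma> \<pi>)}"

text \<open>
  Formal power series in \<open>x\<close> and \<open>q\<close> are series in \<open>x\<close> (outer) whose coefficients are series in
  \<open>q\<close> (inner), so that \<open>f $ m $ n\<close> is the coefficient of \<open>x\<close> to the \<open>m\<close> times \<open>q\<close> to the \<open>n\<close>.
\<close>

definition xq_monom :: "nat \<Rightarrow> nat \<Rightarrow> rat fps fps" where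
  "xq_monom m n = fps_X ^ m * fps_const (fps_X ^ n)"

definition q_pochhammer :: "'a::comm_ring_1 \<Rightarrow> 'a \<Rightarrow> nat \<Rightarrow> 'a" where
  "q_pochhammer a q n = (\<Prod>t<n. 1 - a * q ^ t)"

text \<open>
  Infinite sums of formal power series are taken coefficientwise: a family is summable if every
  monomial occurs in only finitely many members. The metric that the library puts on
  \<^typ>\<open>rat fps fps\<close> gives the coefficients the discrete topology, so it is too fine here:
  infinitely many partitions have the same number of parts.
\<close>

definition formally_summable :: "('i \<Rightarrow> rat fps fps) \<Rightarrow> 'i set \<Rightarrow> bool" where
  "formally_summable f A \<longleftrightarrow> (\<forall>m n. finite {a\<in>A. f a $ m $ n \<noteq> 0})"

definition formal_sum :: "('i \<Rightarrow> rat fps fps) \<Rightarrow> 'i set \<Rightarrow> rat fps fps" where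
  "formal_sum f A = Abs_fps (\<lambda>m. Abs_fps (\<lambda>n. \<Sum>a\<in>{a\<in>A. f a $ m $ n \<noteq> 0}. f a $ m $ n))"

text \<open>
  In the summand of the multisum, \<open>M * (M - 1) div 2\<close> is exact and the truncated subtraction is
  harmless, also for \<open>M = 0\<close>. The denominator has constant coefficient \<open>1\<close>, so that
  \<^const>\<open>inverse\<close> is its true inverse.
\<close>

definition multisum_term :: "nat \<times> nat \<times> nat \<times> nat \<Rightarrow> rat fps fps" where
  "multisum_term = (\<lambda>(i, j, k, l).
     let M = i + 2 * j + 3 * k + 4 * l;
         L = 2 * l ^ 2 + 2 * i + 3 * j + 4 * k + 6 * l;
         q = (fps_X :: rat fps)
     in (-1) ^ l *
        (xq_monom M (M * (M - 1) div 2 + L)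
         + xq_monom (M + 1) ((M + 1) * M div 2 + L + 1)
         + xq_monom (M + 2) ((M + 2) * (M + 1) div 2 + L + 2)
         - xq_monom (M + 3) ((M + 3) * (M + 2) div 2 + L + 4)) *
        fps_const (inverse (q_pochhammer q q i * q_pochhammer (q ^ 2) (q ^ 2) j *
                            q_pochhammer (q ^ 3) (q ^ 3) k * q_pochhammer (q ^ 4) (q ^ 4) l)))"

end

theory Submission
  imports Defs
begin

text \<open>
  Let \<open>E(x)\<close> be the generating function of the partitions avoiding the five infinite families.
  Classifying such a partition by its parts of size close to \<open>1\<close> gives
  \<open>E(x) = E(xq) + xq E(xq\<^sup>2) + x\<^sup>2q\<^sup>3 E(xq\<^sup>3) + x\<^sup>3q\<^sup>6 E(xq\<^sup>4) + x\<^sup>3q\<^sup>4 E(xq\<^sup>3)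
  + x\<^sup>2q\<^sup>2 (E(xq\<^sup>2) - x\<^sup>3q\<^sup>1\<^sup>0 E(xq\<^sup>5))\<close>, and the series of the theorem is
  \<open>E(xq) + xq E(xq\<^sup>2) + x\<^sup>2q\<^sup>3 E(xq\<^sup>3) - x\<^sup>3q\<^sup>7 E(xq\<^sup>4)\<close>.

  On the other side, let \<open>G(y) = \<Sum> A\<^sub>M y\<^sup>M\<close>, where \<open>A\<^sub>M\<close> sums
  \<open>(-1)\<^sup>l q\<^sup>L\<close> over the denominators, for fixed \<open>M\<close>. It is a product of four Euler series, so that
  \<open>(1 - y\<^sup>4q\<^sup>8) G(yq) = (1 - yq\<^sup>2)(1 - y\<^sup>2q\<^sup>3)(1 - y\<^sup>3q\<^sup>4) G(y)\<close>. The factor \<open>1 - yq\<^sup>2\<close>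
  cancels, and what remains says that \<open>F(x) = \<Sum> A\<^sub>M q\<^bsup>M(M-1)/2\<^esup> x\<^sup>M\<close> satisfies the equation
  of \<open>E(xq)\<close>. The equation determines its solution up to the constant term, so \<open>F(x) = E(xq)\<close>,
  and the multisum is \<open>F(x) + xq F(xq) + x\<^sup>2q\<^sup>3 F(xq\<^sup>2) - x\<^sup>3q\<^sup>7 F(xq\<^sup>3)\<close>.
\<close>

section \<open>Dilation and twisting of series\<close>

text \<open>\<open>dilate k f\<close> is \<open>f(xq\<^sup>k)\<close>; \<open>twist\<close> turns \<open>G\<close> into \<open>F\<close>.\<close>

definition dilate :: "nat \<Rightarrow> rat fps fps \<Rightarrow> rat fps fps" where
  "dilate k f = Abs_fps (\<lambda>m. fps_X ^ (k * m) * f $ m)"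

definition twist :: "rat fps fps \<Rightarrow> rat fps fps" where
  "twist f = Abs_fps (\<lambda>m. fps_X ^ (m choose 2) * f $ m)"

lemma dilate_nth [simp]: "dilate k f $ m = fps_X ^ (k * m) * f $ m"
  by (simp add: dilate_def)

lemma twist_nth [simp]: "twist f $ m = fps_X ^ (m choose 2) * f $ m"
  by (simp add: twist_def)

lemma xq_monom_mult_nth: "(xq_monom m n * f) $ k = (if k < m then 0 else fps_X ^ n * f $ (k - m))"
  by (simp add: xq_monom_def mult.assoc fps_X_power_mult_nth)

lemma xq_monom_nth: "xq_monom m n $ a $ b = (if a = m \<and> b = n then 1 else 0)"
  by (simp add: xq_monom_def fps_X_power_mult_nth fps_X_power_nth)

lemma xq_monom_mult: "xq_monom a b * xq_monom c d = xq_monom (a + c) (b + d)"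
  by (simp add: xq_monom_def power_add algebra_simps flip: fps_const_mult)

lemma dilate_add: "dilate k (f + g) = dilate k f + dilate k g"
  and dilate_diff: "dilate k (f - g) = dilate k f - dilate k g"
  and dilate_dilate: "dilate k (dilate l f) = dilate (k + l) f"
  and dilate_0: "dilate 0 f = f"
  by (simp_all add: fps_eq_iff [where 'a = "rat fps"] algebra_simps power_add)

lemma dilate_mult: "dilate k (f * g) = dilate k f * dilate k g"
proof (rule fps_ext)
  fix m
  have "fps_X ^ (k * m) * (f $ i * g $ (m - i)) =
      fps_X ^ (k * i) * f $ i * (fps_X ^ (k * (m - i)) * g $ (m - i))" if "i \<le> m" for i
  proof -
    have "k * m = k * i + k * (m - i)"
      using that by (simp flip: add_mult_distrib2)
    then show ?thesis
      by (simp add: power_add)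
  qed
  then show "dilate k (f * g) $ m = (dilate k f * dilate k g) $ m"
    unfolding dilate_nth fps_mult_nth sum_distrib_left by (intro sum.cong) auto
qed

lemma dilate_xq_monom_mult: "dilate k (xq_monom m n * f) = xq_monom m (n + k * m) * dilate k f"
proof (rule fps_ext)
  fix j
  show "dilate k (xq_monom m n * f) $ j = (xq_monom m (n + k * m) * dilate k f) $ j"
  proof (cases "j < m")
    case False
    then obtain i where "j = m + i"
      by (metis le_Suc_ex not_less)
    then show ?thesis
      by (simp add: xq_monom_mult_nth add_mult_distrib2 power_add)
  qed (simp add: xq_monom_mult_nth)
qed

lemma add_choose_two: "(a + b) choose 2 = (a choose 2) + a * b + (b choose 2)"
  by (induction b) (simp_all add: numeral_2_eq_2)

lemma twist_add: "twist (f + g) = twist f + twist g"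
  and twist_diff: "twist (f - g) = twist f - twist g"
  by (simp_all add: fps_eq_iff [where 'a = "rat fps"] algebra_simps)

text \<open>By \<open>add_choose_two\<close>, passing from exponent i to m + i adds m i to the
  binomial exponent, besides a constant. So \<open>twist\<close> makes a plain factor x^m act with a
  dilation by m, which is how the various dilations of the partition equation arise from the product
  side.\<close>

lemma twist_xq_monom_mult:
  "twist (xq_monom m n * f) = xq_monom m (n + (m choose 2)) * dilate m (twist f)"
proof (rule fps_ext)
  fix j
  show "twist (xq_monom m n * f) $ j =
      (xq_monom m (n + (m choose 2)) * dilate m (twist f)) $ j"
  proof (cases "j < m")
    case False
    then obtain i where "j = m + i"
      by (metis le_Suc_ex not_less)
    then show ?thesis
      by (simp add: xq_monom_mult_nth add_choose_two power_add)
  qed (simp add: xq_monom_mult_nth)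
qed

lemma twist_dilate: "twist (dilate k f) = dilate k (twist f)"
  by (simp add: fps_eq_iff [where 'a = "rat fps"] mult_ac)

lemma one_minus_X_power_neq_0: "0 < m \<Longrightarrow> 1 - fps_X ^ m \<noteq> (0 :: rat fps)"
  by (metis eq_iff_diff_eq_0 fps_X_power_nth fps_one_nth less_irrefl zero_neq_one)

text \<open>Every m is positive, so the sum enters the coefficient of x^j only through coefficients
  of f below j, which vanish by induction. What is left is (1 - q^j) f_j = 0, and 1 - q^j is nonzero
  for j > 0. The lemma is meant for the difference of two solutions.\<close>

lemma dilation_equation_unique:
  fixes R :: "(nat \<times> nat \<times> nat) set" and s :: "nat \<times> nat \<times> nat \<Rightarrow> rat fps fps"
  assumes eq: "f = dilate 1 f + (\<Sum>(m, n, k)\<in>R. s (m, n, k) * (xq_monom m n * dilate k f))"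
    and pos: "\<And>m n k. (m, n, k) \<in> R \<Longrightarrow> 0 < m"
    and init: "f $ 0 = 0"
  shows "f = 0"
proof -
  have "f $ j = 0" for j
  proof (induction j rule: less_induct)
    case (less j)
    show ?case
    proof (cases "j = 0")
      case False
      have "(s r * (xq_monom m n * dilate k f)) $ j = 0" if "0 < m" for r m n k
      proof -
        have "(xq_monom m n * dilate k f) $ i = 0" if "i \<le> j" for i
          using that \<open>0 < m\<close> less by (simp add: xq_monom_mult_nth)
        then show ?thesis
          by (simp add: fps_mult_nth [of "s r"])
      qed
      with pos have "(\<Sum>(m, n, k)\<in>R. s (m, n, k) * (xq_monom m n * dilate k f)) $ j = 0"
        by (auto simp: fps_sum_nth intro!: sum.neutral)
      then have "(dilate 1 f + (\<Sum>(m, n, k)\<in>R. s (m, n, k) * (xq_monom m n * dilate k f))) $ j =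
          fps_X ^ j * f $ j"
        by simp
      moreover have "f $ j =
          (dilate 1 f + (\<Sum>(m, n, k)\<in>R. s (m, n, k) * (xq_monom m n * dilate k f))) $ j"
        by (rule arg_cong [OF eq])
      ultimately have "f $ j = fps_X ^ j * f $ j"
        by (rule trans [rotated])
      then have "(1 - fps_X ^ j) * f $ j = 0"
        by (simp add: algebra_simps)
      with False show ?thesis
        using one_minus_X_power_neq_0 [of j] by auto
    qed (use init in simp)
  qed
  then show ?thesis
    by (simp add: fps_eq_iff [where 'a = "rat fps"])
qed

section \<open>Generating functions of partitions\<close>

abbreviation list_gf :: "nat list set \<Rightarrow> rat fps fps" where
  "list_gf \<equiv> formal_sum (\<lambda>\<pi>. xq_monom (length \<pi>) (sum_list \<pi>))"

text \<open>Zero entries are allowed here; fixing the length together with the sum still leaves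
  finitely many lists.\<close>

lemma finite_lists_length_sum: "finite {\<pi> :: nat list. length \<pi> = m \<and> sum_list \<pi> = n}"
  by (rule finite_subset [OF _ finite_lists_length_eq [of "{..n}" m]])
    (auto simp: member_le_sum_list)

lemma formally_summable_list_weight:
  "formally_summable (\<lambda>\<pi>. xq_monom (length \<pi>) (sum_list \<pi>)) A"
  unfolding formally_summable_def
  by (auto simp: xq_monom_nth intro: rev_finite_subset [OF finite_lists_length_sum])

lemma list_gf_nth:
  "list_gf A $ m $ n = of_nat (card {\<pi> \<in> A. length \<pi> = m \<and> sum_list \<pi> = n})"
proof -
  have "{\<pi> \<in> A. xq_monom (length \<pi>) (sum_list \<pi>) $ m $ n \<noteq> 0} =
      {\<pi> \<in> A. length \<pi> = m \<and> sum_list \<pi> = n}"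
    by (auto simp: xq_monom_nth)
  then show ?thesis
    by (simp add: formal_sum_def xq_monom_nth)
qed

lemma list_gf_Un:
  assumes "A \<inter> B = {}"
  shows "list_gf (A \<union> B) = list_gf A + list_gf B"
proof (intro fps_ext)
  fix m n
  have "{\<pi> \<in> A \<union> B. length \<pi> = m \<and> sum_list \<pi> = n} =
      {\<pi> \<in> A. length \<pi> = m \<and> sum_list \<pi> = n} \<union> {\<pi> \<in> B. length \<pi> = m \<and> sum_list \<pi> = n}"
    by auto
  moreover have "finite {\<pi> \<in> C. length \<pi> = m \<and> sum_list \<pi> = n}" for C
    by (rule rev_finite_subset [OF finite_lists_length_sum [of m n]]) auto
  ultimately show "list_gf (A \<union> B) $ m $ n = (list_gf A + list_gf B) $ m $ n"
    using assms by (simp add: list_gf_nth card_Un_disjoint disjoint_iff flip: of_nat_add)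
qed

lemma list_gf_append:
  "list_gf ((@) \<sigma> ` A) = xq_monom (length \<sigma>) (sum_list \<sigma>) * list_gf A"
proof (intro fps_ext)
  fix m n
  let ?S = "{\<pi> \<in> (@) \<sigma> ` A. length \<pi> = m \<and> sum_list \<pi> = n}"
  show "list_gf ((@) \<sigma> ` A) $ m $ n = (xq_monom (length \<sigma>) (sum_list \<sigma>) * list_gf A) $ m $ n"
  proof (cases "m < length \<sigma> \<or> n < sum_list \<sigma>")
    case True
    then have "?S = {}"
      by auto
    with True show ?thesis
      unfolding list_gf_nth by (simp only: card.empty) (auto simp: xq_monom_mult_nth fps_X_power_mult_nth)
  next
    case False
    then have "?S = (@) \<sigma> ` {\<pi> \<in> A. length \<pi> = m - length \<sigma> \<and> sum_list \<pi> = n - sum_list \<sigma>}"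
      by auto
    then have "card ?S = card {\<pi> \<in> A. length \<pi> = m - length \<sigma> \<and> sum_list \<pi> = n - sum_list \<sigma>}"
      by (simp only:) (rule card_image, simp add: inj_on_def)
    with False show ?thesis
      by (simp add: list_gf_nth xq_monom_mult_nth fps_X_power_mult_nth)
  qed
qed

lemma sum_list_map_add: "sum_list (map ((+) k) \<pi>) = k * length \<pi> + sum_list (\<pi> :: nat list)"
  by (induction \<pi>) simp_all

lemma list_gf_shift: "list_gf (map ((+) k) ` A) = dilate k (list_gf A)"
proof (intro fps_ext)
  fix m n
  let ?S = "{\<pi> \<in> map ((+) k) ` A. length \<pi> = m \<and> sum_list \<pi> = n}"
  show "list_gf (map ((+) k) ` A) $ m $ n = dilate k (list_gf A) $ m $ n"
  proof (cases "n < k * m")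
    case True
    then have "?S = {}"
      by (auto simp: sum_list_map_add)
    with True show ?thesis
      unfolding list_gf_nth by (simp only: card.empty) (simp add: fps_X_power_mult_nth)
  next
    case False
    then have "?S = map ((+) k) ` {\<pi> \<in> A. length \<pi> = m \<and> sum_list \<pi> = n - k * m}"
      by (auto simp: sum_list_map_add)
    then have "card ?S = card {\<pi> \<in> A. length \<pi> = m \<and> sum_list \<pi> = n - k * m}"
      by (simp only:) (rule card_image, simp add: inj_on_def inj_map_eq_map)
    with False show ?thesis
      by (simp add: list_gf_nth fps_X_power_mult_nth)
  qed
qed

section \<open>The partitions avoiding the forbidden families\<close>

definition patterns :: "nat \<Rightarrow> nat list set" where
  "patterns i = {[i, i, i],
                 [i, i + 1, i + 1],
                 [i, i, i + 1, i + 2],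
                 [i, i + 1, i + 2, i + 3],
                 [i, i, i + 2, i + 2, i + 3]}"

text \<open>The lower bound b makes the tail left after removing small parts an object of the same
  kind, a translate of a member of \<open>avoiding 0\<close>. The index \<open>i\<close> may start
  at 0 because every list in \<open>patterns 0\<close> contains the part 0.\<close>

definition avoiding :: "nat \<Rightarrow> nat list set" where
  "avoiding b =
     {\<pi>. sorted \<pi> \<and> (\<forall>p\<in>set \<pi>. b < p) \<and> (\<forall>i. \<forall>\<sigma>\<in>patterns i. \<not> sublist \<sigma> \<pi>)}"

lemma prefix_Cons_conv: "prefix (x # xs) ys \<longleftrightarrow> (\<exists>zs. ys = x # zs \<and> prefix xs zs)"
  by (cases ys) auto

lemma Nil_in_avoiding [simp]: "[] \<in> avoiding b"
  by (auto simp: avoiding_def patterns_def)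

text \<open>Each list in \<open>patterns i\<close> begins with \<open>i\<close>, so an occurrence
  that is not already inside \<open>\<pi>\<close> starts at the head and has i = p. The five
  prefixes are the patterns at p without their first part.\<close>

lemma Cons_in_avoiding_iff:
  "p # \<pi> \<in> avoiding b \<longleftrightarrow> b < p \<and> (\<forall>r\<in>set \<pi>. p \<le> r) \<and> \<pi> \<in> avoiding b \<and>
     \<not> prefix [p, p] \<pi> \<and> \<not> prefix [p + 1, p + 1] \<pi> \<and> \<not> prefix [p, p + 1, p + 2] \<pi> \<and>
     \<not> prefix [p + 1, p + 2, p + 3] \<pi> \<and> \<not> prefix [p, p + 2, p + 2, p + 3] \<pi>"
  by (auto simp: avoiding_def patterns_def sublist_Cons_right)

lemma avoiding_iff: "\<pi> \<in> avoiding c \<longleftrightarrow> \<pi> \<in> avoiding b \<and> (\<forall>p\<in>set \<pi>. c < p)" if "b \<le> c"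
  using that by (auto simp: avoiding_def)

lemma avoiding_mono: "\<pi> \<in> avoiding c \<Longrightarrow> b \<le> c \<Longrightarrow> \<pi> \<in> avoiding b"
  by (auto simp: avoiding_def)

lemma avoiding_greater: "\<pi> \<in> avoiding b \<Longrightarrow> p \<in> set \<pi> \<Longrightarrow> b < p"
  by (auto simp: avoiding_def)

text \<open>The patterns are translation invariant; in the prefix form of
  \<open>Cons_in_avoiding_iff\<close> this can be checked one part at a time.\<close>

lemma avoiding_shift: "avoiding b = map ((+) b) ` avoiding 0"
proof
  have prefix_map: "prefix (map ((+) b) \<sigma>) (map ((+) b) \<pi>) \<longleftrightarrow> prefix \<sigma> \<pi>" for \<sigma> \<pi>
  proof -
    have "inj ((+) b)"
      by simp
    then show ?thesis
      by (metis (no_types, lifting) append_eq_map_conv inj_map_eq_map map_append prefix_def)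
  qed
  have shift: "map ((+) b) \<pi> \<in> avoiding b \<longleftrightarrow> \<pi> \<in> avoiding 0" for \<pi>
  proof (induction \<pi>)
    case (Cons p \<pi>)
    show ?case
      using Cons prefix_map [of "[p, p]" \<pi>] prefix_map [of "[p + 1, p + 1]" \<pi>]
        prefix_map [of "[p, p + 1, p + 2]" \<pi>] prefix_map [of "[p + 1, p + 2, p + 3]" \<pi>]
        prefix_map [of "[p, p + 2, p + 2, p + 3]" \<pi>]
      by (simp add: Cons_in_avoiding_iff add.assoc)
  qed simp
  then show "map ((+) b) ` avoiding 0 \<subseteq> avoiding b"
    by auto
  show "avoiding b \<subseteq> map ((+) b) ` avoiding 0"
  proof
    fix \<pi> assume \<pi>: "\<pi> \<in> avoiding b"
    have "map ((+) b) (map (\<lambda>p. p - b) \<pi>) = \<pi>"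
      using avoiding_greater [OF \<pi>] by (auto intro!: map_idI simp: less_imp_le)
    with \<pi> shift show "\<pi> \<in> map ((+) b) ` avoiding 0"
      by (metis imageI)
  qed
qed

text \<open>The lists that may follow two parts \<open>b - 1\<close> when \<open>b\<close> does not occur.\<close>

definition avoiding' :: "nat \<Rightarrow> nat list set" where
  "avoiding' b = {\<pi> \<in> avoiding b. \<not> prefix [b + 1, b + 1, b + 2] \<pi>}"

lemma not_prefix_avoiding: "\<pi> \<in> avoiding c \<Longrightarrow> p \<le> c \<Longrightarrow> \<not> prefix (p # \<sigma>) \<pi>"
  by (auto simp: prefix_Cons_conv dest: avoiding_greater)

text \<open>Iterating this rule reads off the parts b + 1, b + 2, ... of a sorted list one by
  one.\<close>

lemma avoiding_cases:
  assumes "\<pi> \<in> avoiding b"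
  obtains "\<pi> \<in> avoiding (b + 1)"
  | \<rho> where "\<pi> = (b + 1) # \<rho>" "\<rho> \<in> avoiding b"
proof (cases \<pi>)
  case Nil
  with that show ?thesis
    by simp
next
  case (Cons p \<rho>)
  then have "b < p" "\<forall>r\<in>set \<rho>. p \<le> r" "\<rho> \<in> avoiding b"
    using assms by (auto simp: Cons_in_avoiding_iff)
  show ?thesis
  proof (cases "p = b + 1")
    case False
    then have "\<forall>r\<in>set \<pi>. b + 1 < r"
      using Cons \<open>b < p\<close> \<open>\<forall>r\<in>set \<rho>. p \<le> r\<close> by fastforce
    then show ?thesis
      using assms that(1) avoiding_iff [of b "b + 1" \<pi>] by simp
  qed (use Cons that \<open>\<rho> \<in> avoiding b\<close> in simp)
qed

text \<open>The part b + 1 occurs at most twice. After one b + 1 there is at most one b + 2; if it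
  occurs, at most one b + 3 follows, and then no b + 4. After two parts b + 1 there is at most one b
  + 2, which excludes b + 3; without b + 2 the tail must not start with b + 3, b + 3, b + 4.\<close>

lemma avoiding_decomp:
  "avoiding b = avoiding (b + 1) \<union> ((@) [b + 1] ` avoiding (b + 2) \<union>
     ((@) [b + 1, b + 2] ` avoiding (b + 3) \<union> ((@) [b + 1, b + 2, b + 3] ` avoiding (b + 4) \<union>
     ((@) [b + 1, b + 1, b + 2] ` avoiding (b + 3) \<union> (@) [b + 1, b + 1] ` avoiding' (b + 2)))))"
  (is "_ = ?R")
proof
  \<comment> \<open>In facts 1 to 4 the tail starts too high for a pattern to straddle the junction.
    In 5 only the pattern of length five could do so, and the second hypothesis rules it
    out.\<close>
  have 1: "(b + 1) # \<rho> \<in> avoiding b" if "\<rho> \<in> avoiding (b + 2)" for \<rho>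
    using that avoiding_greater [OF that] avoiding_mono [OF that, of b]
    by (fastforce simp: Cons_in_avoiding_iff not_prefix_avoiding)
  have 2: "(b + 1) # (b + 2) # \<rho> \<in> avoiding b" if "\<rho> \<in> avoiding (b + 3)" for \<rho>
    using that avoiding_greater [OF that] avoiding_mono [OF that, of b]
    by (fastforce simp: Cons_in_avoiding_iff not_prefix_avoiding)
  have 3: "(b + 1) # (b + 2) # (b + 3) # \<rho> \<in> avoiding b" if "\<rho> \<in> avoiding (b + 4)" for \<rho>
    using that avoiding_greater [OF that] avoiding_mono [OF that, of b]
    by (fastforce simp: Cons_in_avoiding_iff not_prefix_avoiding)
  have 4: "(b + 1) # (b + 1) # (b + 2) # \<rho> \<in> avoiding b" if "\<rho> \<in> avoiding (b + 3)" for \<rho>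
    using that avoiding_greater [OF that] avoiding_mono [OF that, of b]
    by (fastforce simp: Cons_in_avoiding_iff not_prefix_avoiding)
  have 5: "(b + 1) # (b + 1) # \<rho> \<in> avoiding b"
    if "\<rho> \<in> avoiding (b + 2)" "\<not> prefix [b + 3, b + 3, b + 4] \<rho>" for \<rho>
    using that avoiding_greater [OF that(1)] avoiding_mono [OF that(1), of b]
    by (fastforce simp: Cons_in_avoiding_iff not_prefix_avoiding eval_nat_numeral)
  show "?R \<subseteq> avoiding b"
    using 1 2 3 4 5 avoiding_mono [of _ "b + 1" b]
    by (auto simp: avoiding'_def eval_nat_numeral)
  show "avoiding b \<subseteq> ?R"
  proof
    fix \<pi> assume \<pi>: "\<pi> \<in> avoiding b"
    then show "\<pi> \<in> ?R"
    proof (cases rule: avoiding_cases)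
      case (2 \<rho>)
      note \<pi>\<rho> = \<pi> [unfolded 2(1) Cons_in_avoiding_iff]
      from \<open>\<rho> \<in> avoiding b\<close> show ?thesis
      proof (cases rule: avoiding_cases)
        \<comment> \<open>Exactly one part b + 1. The branches with a second b + 2, a second b + 3,
          or a b + 4 after b + 3 each complete a pattern.\<close>
        case 1
        then show ?thesis
        proof (cases rule: avoiding_cases)
          case 1
          then show ?thesis
            using \<pi>\<rho> 2(1) by simp
        next
          case (2 \<rho>')
          from \<open>\<rho>' \<in> avoiding (b + 1)\<close> show ?thesis
          proof (cases rule: avoiding_cases)
            case 1
            then show ?thesis
            proof (cases rule: avoiding_cases)
              case (2 \<rho>'')
              from \<open>\<rho>'' \<in> avoiding (b + 1 + 1)\<close> show ?thesis
              proof (cases rule: avoiding_cases)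
                case 1
                then show ?thesis
                  by (cases rule: avoiding_cases)
                    (use \<pi>\<rho> \<open>\<pi> = _\<close> \<open>\<rho> = _\<close> \<open>\<rho>' = _\<close> in
                      \<open>auto simp: eval_nat_numeral Cons_in_avoiding_iff\<close>)
              qed (use \<pi>\<rho> \<open>\<rho> = _\<close> \<open>\<rho>' = _\<close> in
                \<open>auto simp: eval_nat_numeral Cons_in_avoiding_iff\<close>)
            qed (use \<open>\<pi> = _\<close> \<open>\<rho> = _\<close> in
              \<open>simp add: eval_nat_numeral\<close>)
          qed (use \<pi>\<rho> \<open>\<rho> = _\<close> in \<open>auto simp: eval_nat_numeral\<close>)
        qed
      next
        \<comment> \<open>At least two parts b + 1. A third one, a second b + 2, or a b + 3 after b
          + 2 completes a pattern.\<close>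
        case (2 \<rho>')
        from \<open>\<rho>' \<in> avoiding b\<close> show ?thesis
        proof (cases rule: avoiding_cases)
          case 1
          then show ?thesis
          proof (cases rule: avoiding_cases)
            case 1
            then show ?thesis
              using \<pi>\<rho> \<open>\<pi> = _\<close> \<open>\<rho> = _\<close> by (simp add: avoiding'_def eval_nat_numeral)
          next
            case (2 \<rho>'')
            from \<open>\<rho>'' \<in> avoiding (b + 1)\<close> show ?thesis
            proof (cases rule: avoiding_cases)
              case 1
              then show ?thesis
                by (cases rule: avoiding_cases)
                  (use \<pi>\<rho> \<open>\<pi> = _\<close> \<open>\<rho> = _\<close> \<open>\<rho>' = _\<close> in
                    \<open>auto simp: eval_nat_numeral\<close>)
            qed (use \<pi>\<rho> \<open>\<rho> = _\<close> \<open>\<rho>' = _\<close> in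
              \<open>auto simp: eval_nat_numeral Cons_in_avoiding_iff\<close>)
          qed
        qed (use \<pi>\<rho> \<open>\<rho> = _\<close> in \<open>auto simp: eval_nat_numeral\<close>)
      qed
    qed simp
  qed
qed

section \<open>The three extra forbidden sub-partitions\<close>

lemma not_sublist_avoiding: "\<pi> \<in> avoiding c \<Longrightarrow> p \<le> c \<Longrightarrow> \<not> sublist (p # \<sigma>) \<pi>"
  using avoiding_greater [of \<pi> c p] set_mono_sublist [of "p # \<sigma>" \<pi>] by auto

lemma restricted_partitions_iff:
  "\<pi> \<in> restricted_partitions \<longleftrightarrow> \<pi> \<in> avoiding 0 \<and>
     \<not> sublist [1, 1] \<pi> \<and> \<not> sublist [1, 2, 3] \<pi> \<and> \<not> sublist [2, 2, 3] \<pi>"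
proof -
  \<comment> \<open>Index 0 is vacuous for positive parts, which reconciles the range i >= 1 of
    \<open>forbidden\<close> with the unrestricted index in \<open>avoiding\<close>.\<close>
  have "\<not> sublist \<sigma> \<pi>" if "\<sigma> \<in> patterns 0" "\<forall>p\<in>set \<pi>. 0 < p" for \<sigma>
    using that set_mono_sublist [of \<sigma> \<pi>] by (auto simp: patterns_def)
  then have "(\<forall>i. \<forall>\<sigma>\<in>patterns i. \<not> sublist \<sigma> \<pi>) \<longleftrightarrow> (\<forall>i\<in>{1..}. \<forall>\<sigma>\<in>patterns i. \<not> sublist \<sigma> \<pi>)"
    if "\<forall>p\<in>set \<pi>. 0 < p"
    using that by (metis atLeast_iff less_one not_less)
  moreover have forbidden: "forbidden = {[1, 1], [1, 2, 3], [2, 2, 3]} \<union> (\<Union>i\<in>{1..}. patterns i)"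
    by (simp add: forbidden_def patterns_def)
  ultimately show ?thesis
    unfolding restricted_partitions_def is_partition_def avoiding_def forbidden ball_Un by auto
qed

text \<open>By 1+1 there is at most one part 1. If there is none, only 2+2+3 remains to be excluded.
  If there is one, 1+2+2 allows at most one 2, and a 2 excludes 3 by 1+2+3; then 2+2+3 cannot
  occur.\<close>

lemma restricted_partitions_decomp:
  "restricted_partitions = avoiding' 1 \<union> ((@) [1] ` avoiding 2 \<union> (@) [1, 2] ` avoiding 3)"
  (is "_ = ?R")
proof
  \<comment> \<open>With all parts at least 2, an occurrence of 2+2+3 away from the start would be
    preceded by a third 2.\<close>
  have no_223: "\<not> sublist [2, 2, 3] \<pi>" if \<pi>: "\<pi> \<in> avoiding' 1" for \<pi>
  proof -
    from \<pi> have "\<pi> \<in> avoiding 1"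
      by (simp add: avoiding'_def)
    then show ?thesis
    proof (cases rule: avoiding_cases)
      case (2 \<rho>)
      note \<pi>\<rho> = \<pi> [unfolded 2(1) avoiding'_def mem_Collect_eq Cons_in_avoiding_iff]
      from \<open>\<rho> \<in> avoiding 1\<close> show ?thesis
      proof (cases rule: avoiding_cases)
        case 1
        then show ?thesis
          using \<pi>\<rho> 2 by (simp add: sublist_Cons_right not_sublist_avoiding not_prefix_avoiding)
      next
        case (2 \<rho>')
        from \<open>\<rho>' \<in> avoiding 1\<close> show ?thesis
          by (cases rule: avoiding_cases)
            (use \<pi>\<rho> \<open>\<pi> = _\<close> \<open>\<rho> = _\<close> in
              \<open>auto simp: sublist_Cons_right not_sublist_avoiding eval_nat_numeral prefix_Cons_conv\<close>)
      qed
    qed (simp add: not_sublist_avoiding)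
  qed
  have "1 # \<rho> \<in> avoiding 0" if "\<rho> \<in> avoiding 2" for \<rho>
    using avoiding_decomp [of 0] that by (auto simp: eval_nat_numeral)
  moreover have "1 # 2 # \<rho> \<in> avoiding 0" if "\<rho> \<in> avoiding 3" for \<rho>
    using avoiding_decomp [of 0] that by (auto simp: eval_nat_numeral)
  ultimately show "?R \<subseteq> restricted_partitions"
    using no_223
    by (auto simp: restricted_partitions_iff avoiding'_def sublist_Cons_right
        not_sublist_avoiding not_prefix_avoiding intro: avoiding_mono)
  show "restricted_partitions \<subseteq> ?R"
  proof
    fix \<pi> assume "\<pi> \<in> restricted_partitions"
    then have \<pi>: "\<pi> \<in> avoiding 0" and
      no: "\<not> sublist [1, 1] \<pi>" "\<not> sublist [1, 2, 3] \<pi>" "\<not> sublist [2, 2, 3] \<pi>"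
      by (simp_all add: restricted_partitions_iff)
    from \<pi> show "\<pi> \<in> ?R"
    proof (cases rule: avoiding_cases)
      case 1
      then show ?thesis
        using no by (auto simp: avoiding'_def eval_nat_numeral dest: prefix_imp_sublist)
    next
      case (2 \<rho>)
      note \<pi>\<rho> = \<pi> [unfolded 2(1) Cons_in_avoiding_iff]
      from \<open>\<rho> \<in> avoiding 0\<close> show ?thesis
      proof (cases rule: avoiding_cases)
        case 1
        then show ?thesis
        proof (cases rule: avoiding_cases)
          case 1
          then show ?thesis
            using 2(1) by (simp add: eval_nat_numeral)
        next
          case (2 \<rho>')
          from \<open>\<rho>' \<in> avoiding (0 + 1)\<close> show ?thesis
          proof (cases rule: avoiding_cases)
            case 1
            then show ?thesis
              by (cases rule: avoiding_cases)
                (use no \<open>\<pi> = _\<close> \<open>\<rho> = _\<close> in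
                  \<open>auto simp: eval_nat_numeral\<close>)
          qed (use \<pi>\<rho> \<open>\<rho> = _\<close> in \<open>auto simp: eval_nat_numeral\<close>)
        qed
      qed (use no \<open>\<pi> = _\<close> in auto)
    qed
  qed
qed

section \<open>Functional equations on the partition side\<close>

lemma list_gf_avoiding: "list_gf (avoiding b) = dilate b (list_gf (avoiding 0))"
  by (subst avoiding_shift) (rule list_gf_shift)

text \<open>By \<open>avoiding_decomp\<close>, the lists removed from \<open>avoiding b\<close> are
  exactly b + 1, b + 1, b + 2 followed by a member of \<open>avoiding (b + 3)\<close>; the block has
  sum 3b + 4.\<close>

lemma list_gf_avoiding':
  "list_gf (avoiding' b) = dilate b (list_gf (avoiding 0)) -
     xq_monom 3 (3 * b + 4) * dilate (b + 3) (list_gf (avoiding 0))"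
proof -
  let ?A = "(@) [b + 1, b + 1, b + 2] ` avoiding (b + 3)"
  have "\<pi> \<in> ?A" if "\<pi> \<in> avoiding b" "prefix [b + 1, b + 1, b + 2] \<pi>" for \<pi>
    using that avoiding_decomp [of b]
    by (auto simp: prefix_Cons_conv avoiding'_def dest!: avoiding_greater)
  moreover have "?A \<subseteq> avoiding b"
    using avoiding_decomp [of b] by blast
  ultimately have "avoiding b = avoiding' b \<union> ?A" "avoiding' b \<inter> ?A = {}"
    by (auto simp: avoiding'_def)
  then have "list_gf (avoiding b) = list_gf (avoiding' b) + list_gf ?A"
    using list_gf_Un by metis
  then show ?thesis
    unfolding list_gf_append list_gf_avoiding [of b] list_gf_avoiding [of "b + 3"]
    by (simp add: algebra_simps eval_nat_numeral)
qed

text \<open>The pieces of \<open>avoiding_decomp\<close> at b = 0 are pairwise disjoint. The last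
  term is x^2 q^2 from the two parts 1, times x^3 q^10 from the excluded block 3+3+4.\<close>

lemma list_gf_avoiding_equation:
  fixes e :: "rat fps fps"
  defines "e \<equiv> list_gf (avoiding 0)"
  shows "e = dilate 1 e + xq_monom 1 1 * dilate 2 e + xq_monom 2 3 * dilate 3 e
    + xq_monom 3 6 * dilate 4 e + xq_monom 3 4 * dilate 3 e + xq_monom 2 2 * dilate 2 e
    - xq_monom 5 12 * dilate 5 e"
proof -
  let ?A = "(@) [1 :: nat] ` avoiding 2" and ?B = "(@) [1, 2 :: nat] ` avoiding 3"
    and ?C = "(@) [1, 2, 3 :: nat] ` avoiding 4" and ?D = "(@) [1, 1, 2 :: nat] ` avoiding 3"
    and ?E = "(@) [1, 1 :: nat] ` avoiding' 2"
  have "avoiding 0 = avoiding 1 \<union> (?A \<union> (?B \<union> (?C \<union> (?D \<union> ?E))))"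
    using avoiding_decomp [of 0] by (simp add: eval_nat_numeral)
  moreover have "avoiding 1 \<inter> (?A \<union> (?B \<union> (?C \<union> (?D \<union> ?E)))) = {}"
    by (auto dest: avoiding_greater)
  moreover have "?A \<inter> (?B \<union> (?C \<union> (?D \<union> ?E))) = {}"
    by (auto dest: avoiding_greater)
  moreover have "?B \<inter> (?C \<union> (?D \<union> ?E)) = {}"
    by (auto dest: avoiding_greater)
  moreover have "?C \<inter> (?D \<union> ?E) = {}"
    by auto
  moreover have "?D \<inter> ?E = {}"
    by (auto simp: avoiding'_def dest: avoiding_greater)
  ultimately have "e = list_gf (avoiding 1) +
      (list_gf ?A + (list_gf ?B + (list_gf ?C + (list_gf ?D + list_gf ?E))))"
    unfolding e_def by (simp only: list_gf_Un)
  then show ?thesis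
    unfolding list_gf_append
    by (simp add: list_gf_avoiding' list_gf_avoiding [of "Suc 0"] list_gf_avoiding [of "Suc (Suc 0)"]
        list_gf_avoiding [of "Suc (Suc (Suc 0))"] list_gf_avoiding [of "Suc (Suc (Suc (Suc 0)))"] right_diff_distrib xq_monom_mult
        eval_nat_numeral add.assoc add_diff_eq flip: e_def mult.assoc)
qed

lemma list_gf_restricted_partitions:
  fixes e :: "rat fps fps"
  defines "e \<equiv> list_gf (avoiding 0)"
  shows "list_gf restricted_partitions = dilate 1 e - xq_monom 3 7 * dilate 4 e
    + xq_monom 1 1 * dilate 2 e + xq_monom 2 3 * dilate 3 e"
proof -
  have "avoiding' 1 \<inter> ((@) [1] ` avoiding 2 \<union> (@) [1, 2] ` avoiding 3) = {}"
    by (auto simp: avoiding'_def dest: avoiding_greater)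
  moreover have "(@) [1] ` avoiding 2 \<inter> (@) [1, 2] ` avoiding 3 = {}"
    by (auto dest: avoiding_greater)
  ultimately have "list_gf restricted_partitions = list_gf (avoiding' 1) +
      (list_gf ((@) [1] ` avoiding 2) + list_gf ((@) [1, 2] ` avoiding 3))"
    unfolding restricted_partitions_decomp by (simp only: list_gf_Un)
  then show ?thesis
    unfolding list_gf_append
    by (simp add: list_gf_avoiding' list_gf_avoiding [of "Suc (Suc 0)"]
        list_gf_avoiding [of "Suc (Suc (Suc 0))"]
        eval_nat_numeral flip: e_def)
qed

lemma list_gf_avoiding_nth_0: "list_gf (avoiding 0) $ 0 = 1"
proof (rule fps_ext)
  fix n
  have "{\<pi> \<in> avoiding 0. length \<pi> = 0 \<and> sum_list \<pi> = n} = (if n = 0 then {[]} else {})"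
    by auto
  then show "list_gf (avoiding 0) $ 0 $ n = 1 $ n"
    by (simp add: list_gf_nth)
qed

section \<open>The multisum\<close>

definition weight_gf :: "('a \<Rightarrow> nat) \<Rightarrow> ('a \<Rightarrow> rat fps) \<Rightarrow> rat fps fps" where
  "weight_gf w c = Abs_fps (\<lambda>m. \<Sum>a | w a = m. c a)"

lemma weight_gf_nth: "weight_gf w c $ m = (\<Sum>a | w a = m. c a)"
  by (simp add: weight_gf_def)

lemma finite_weight_prod:
  fixes w :: "'a \<Rightarrow> nat" and v :: "'b \<Rightarrow> nat"
  assumes "\<And>m. finite {a. w a = m}" "\<And>m. finite {b. v b = m}"
  shows "finite {p. (case p of (a, b) \<Rightarrow> w a + v b) = m}"
proof (rule finite_subset)
  show "{p. (case p of (a, b) \<Rightarrow> w a + v b) = m} \<subseteq>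
      (\<Union>i\<le>m. {a. w a = i}) \<times> (\<Union>i\<le>m. {b. v b = i})"
    by auto
  show "finite ((\<Union>i\<le>m. {a. w a = i}) \<times> (\<Union>i\<le>m. {b. v b = i}))"
    using assms by auto
qed

text \<open>This is the Cauchy product. Finite fibres matter, since a sum over an infinite fibre
  would take the default value 0.\<close>

lemma weight_gf_mult:
  fixes w :: "'a \<Rightarrow> nat" and v :: "'b \<Rightarrow> nat"
  assumes "\<And>m. finite {a. w a = m}" "\<And>m. finite {b. v b = m}"
  shows "weight_gf w c * weight_gf v d =
    weight_gf (\<lambda>(a, b). w a + v b) (\<lambda>(a, b). c a * d b)"
proof (rule fps_ext)
  fix m
  have "{p. (case p of (a, b) \<Rightarrow> w a + v b) = m} =
      (\<Union>i\<in>{0..m}. {a. w a = i} \<times> {b. v b = m - i})"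
    by auto
  moreover have "sum (\<lambda>(a, b). c a * d b) (\<Union>i\<in>{0..m}. {a. w a = i} \<times> {b. v b = m - i}) =
      (\<Sum>i=0..m. sum (\<lambda>(a, b). c a * d b) ({a. w a = i} \<times> {b. v b = m - i}))"
    using assms by (intro sum.UNION_disjoint) auto
  ultimately show "(weight_gf w c * weight_gf v d) $ m =
      weight_gf (\<lambda>(a, b). w a + v b) (\<lambda>(a, b). c a * d b) $ m"
    by (simp add: fps_mult_nth weight_gf_nth sum_product sum.cartesian_product)
qed

lemma weight_gf_multiples_nth:
  assumes "0 < d"
  shows "weight_gf (\<lambda>n. d * n) c $ m = (if d dvd m then c (m div d) else 0)"
proof -
  have "{n. d * n = m} = (if d dvd m then {m div d} else {})"
    using assms by auto
  then show ?thesis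
    by (simp add: weight_gf_nth)
qed

text \<open>Both Euler series are covered: t = 0 is the case of linear exponents, t = 1 that of
  quadratic ones. The equation is the recurrence (1 - q^(d(n+1))) c(n+1) = s q^(e+tdn) c(n), read
  off at x^(d(n+1)).\<close>

lemma euler_series_equation:
  fixes d e t :: nat and a :: "nat \<Rightarrow> nat" and s :: "rat fps"
  defines "c \<equiv> \<lambda>n. s ^ n * fps_X ^ a n * inverse (q_pochhammer (fps_X ^ d) (fps_X ^ d) n)"
  assumes "0 < d" and a: "\<And>n. a (Suc n) = a n + e + t * (d * n)"
  shows "weight_gf (\<lambda>n. d * n) c = dilate 1 (weight_gf (\<lambda>n. d * n) c)
    + fps_const s * (xq_monom d e * dilate t (weight_gf (\<lambda>n. d * n) c))"
proof (rule fps_ext)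
  fix m
  have step: "c (Suc n) = fps_X ^ (d * Suc n) * c (Suc n) + s * fps_X ^ (e + t * (d * n)) * c n" for n
  proof -
    define b :: "rat fps" where "b = 1 - fps_X ^ (d * Suc n)"
    have "b $ 0 \<noteq> 0"
      using \<open>0 < d\<close> by (simp add: b_def)
    then have b: "inverse b * b = 1"
      by (rule inverse_mult_eq_1)
    have "q_pochhammer (fps_X ^ d) (fps_X ^ d) (Suc n) = q_pochhammer (fps_X ^ d) (fps_X ^ d) n * b"
      by (simp add: q_pochhammer_def b_def power_add flip: power_mult)
    then have "c (Suc n) = s * fps_X ^ (e + t * (d * n)) * c n * inverse b"
      by (simp add: c_def a fps_inverse_mult power_add mult_ac)
    then have "c (Suc n) * b = s * fps_X ^ (e + t * (d * n)) * c n"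
      using b by (simp add: mult.assoc)
    then show ?thesis
      by (simp add: b_def algebra_simps)
  qed
  show "weight_gf (\<lambda>n. d * n) c $ m = (dilate 1 (weight_gf (\<lambda>n. d * n) c)
    + fps_const s * (xq_monom d e * dilate t (weight_gf (\<lambda>n. d * n) c))) $ m"
  proof (cases "m = 0 \<or> \<not> d dvd m")
    case True
    \<comment> \<open>At m = 0 the monomial contributes nothing because d > 0, and dilation fixes
      the constant coefficient. Off the multiples of d all terms vanish.\<close>
    then have "m < d \<or> \<not> d dvd m \<and> \<not> d dvd (m - d)"
      using \<open>0 < d\<close> by (auto simp: dvd_minus_self)
    with True \<open>0 < d\<close> show ?thesis
      by (auto simp: weight_gf_multiples_nth xq_monom_mult_nth)
  next
    case False
    then obtain n where "m = d * Suc n"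
      by (metis dvdE mult_0_right not0_implies_Suc)
    moreover have "d * Suc n - d = d * n"
      by simp
    ultimately show ?thesis
      using step [of n] \<open>0 < d\<close>
      by (simp add: weight_gf_multiples_nth xq_monom_mult_nth power_add mult.assoc
          del: mult_Suc_right)
  qed
qed

type_synonym quad = "nat \<times> nat \<times> nat \<times> nat"

definition quad_weight :: "quad \<Rightarrow> nat" where
  "quad_weight = (\<lambda>(i, j, k, l). i + 2 * j + 3 * k + 4 * l)"

text \<open>The factor q^(M(M-1)/2) is left out, so that
  \<open>weight_gf quad_weight quad_coeff\<close> is the series G and factors; \<open>twist\<close>
  restores it.\<close>

definition quad_coeff :: "quad \<Rightarrow> rat fps" where
  "quad_coeff = (\<lambda>(i, j, k, l).
     (-1) ^ l * fps_X ^ (2 * l ^ 2 + 2 * i + 3 * j + 4 * k + 6 * l) *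
     inverse (q_pochhammer fps_X fps_X i * q_pochhammer (fps_X ^ 2) (fps_X ^ 2) j *
              q_pochhammer (fps_X ^ 3) (fps_X ^ 3) k * q_pochhammer (fps_X ^ 4) (fps_X ^ 4) l))"

lemma finite_quad_weight: "finite {a. quad_weight a = m}"
proof (rule finite_subset)
  show "{a. quad_weight a = m} \<subseteq> {..m} \<times> {..m} \<times> {..m} \<times> {..m}"
    by (auto simp: quad_weight_def)
qed auto

lemma quad_gf_equation:
  fixes g :: "rat fps fps"
  defines "g \<equiv> weight_gf quad_weight quad_coeff"
  shows "g = dilate 1 g + xq_monom 1 2 * dilate 1 g + xq_monom 2 4 * dilate 1 g
    + xq_monom 3 6 * dilate 1 g + xq_monom 2 3 * g + xq_monom 3 4 * g - xq_monom 5 7 * g"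
proof -
  define S where "S d s a = weight_gf (\<lambda>n. d * n)
      (\<lambda>n. s ^ n * fps_X ^ a n * inverse (q_pochhammer (fps_X ^ d) (fps_X ^ d) n))"
    for d :: nat and s :: "rat fps" and a :: "nat \<Rightarrow> nat"
  define g1 where "g1 = S 1 1 (\<lambda>n. 2 * n)"
  define g2 where "g2 = S 2 1 (\<lambda>n. 3 * n)"
  define g3 where "g3 = S 3 1 (\<lambda>n. 4 * n)"
  define g4 where "g4 = S 4 (-1) (\<lambda>n. 2 * n ^ 2 + 6 * n)"
  have fin: "finite {n. d * n = m}" if "0 < d" for d m :: nat
    by (rule finite_subset [of _ "{..m}"]) (use that in auto)
  \<comment> \<open>Both M and L are sums of functions of i, j, k and l separately. The product is
    nested to the right to match the shape of a quadruple.\<close>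
  have g: "g = g1 * (g2 * (g3 * g4))"
    unfolding g_def g1_def g2_def g3_def g4_def S_def
    by (subst weight_gf_mult finite_weight_prod; (intro fin finite_weight_prod)?; simp?)+
      (auto simp: quad_weight_def quad_coeff_def fun_eq_iff fps_inverse_mult power_add algebra_simps
        intro!: arg_cong2 [of _ _ _ _ weight_gf])
  have "g1 = dilate 1 g1 + fps_const 1 * (xq_monom 1 2 * dilate 0 g1)"
    unfolding g1_def S_def by (rule euler_series_equation) auto
  then have 1: "dilate 1 g1 = (1 - xq_monom 1 2) * g1"
    by (simp add: dilate_0 algebra_simps)
  have "g2 = dilate 1 g2 + fps_const 1 * (xq_monom 2 3 * dilate 0 g2)"
    unfolding g2_def S_def by (rule euler_series_equation) auto
  then have 2: "dilate 1 g2 = (1 - xq_monom 2 3) * g2"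
    by (simp add: dilate_0 algebra_simps)
  have "g3 = dilate 1 g3 + fps_const 1 * (xq_monom 3 4 * dilate 0 g3)"
    unfolding g3_def S_def by (rule euler_series_equation) auto
  then have 3: "dilate 1 g3 = (1 - xq_monom 3 4) * g3"
    by (simp add: dilate_0 algebra_simps)
  \<comment> \<open>The exponent 2n^2 + 6n has increments 8 + 4n, so here t = 1 and e = 8; the three
    linear exponents above have t = 0.\<close>
  have "g4 = dilate 1 g4 + fps_const (-1) * (xq_monom 4 8 * dilate 1 g4)"
    unfolding g4_def S_def
    by (rule euler_series_equation) (auto simp: power2_eq_square algebra_simps)
  then have 4: "g4 = (1 - xq_monom 4 8) * dilate 1 g4"
    by (simp add: algebra_simps flip: fps_const_neg)
  \<comment> \<open>This \<open>y\<close> is the product yq^2 of the introductory text. It turns 1 -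
    y^4q^8 into 1 - \<open>y ^ 4\<close>, which has the factor 1 - \<open>y\<close>.\<close>
  define y where "y = xq_monom 1 2"
  have y: "xq_monom 2 4 = y ^ 2" "xq_monom 3 6 = y ^ 3" "xq_monom 4 8 = y ^ 4"
    by (simp_all add: y_def xq_monom_mult eval_nat_numeral)
  have "(1 - y) * ((1 + y + y ^ 2 + y ^ 3) * dilate 1 g) =
      dilate 1 g1 * dilate 1 g2 * dilate 1 g3 * ((1 - y ^ 4) * dilate 1 g4)"
    unfolding g dilate_mult by algebra
  also have "\<dots> = (1 - y) * ((1 - xq_monom 2 3) * (1 - xq_monom 3 4) * g)"
    unfolding 1 [folded y_def] 2 3 4 [unfolded y, symmetric] g by (simp only: mult_ac)
  finally have "(1 - y) * ((1 + y + y ^ 2 + y ^ 3) * dilate 1 g) =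
      (1 - y) * ((1 - xq_monom 2 3) * (1 - xq_monom 3 4) * g)" .
  moreover have "1 - y \<noteq> 0"
  proof -
    have "(1 - y) $ 0 = 1"
      using xq_monom_mult_nth [of 1 2 1 0] by (simp add: y_def)
    then show ?thesis
      by auto
  qed
  ultimately have "(1 + y + y ^ 2 + y ^ 3) * dilate 1 g =
      (1 - xq_monom 2 3) * (1 - xq_monom 3 4) * g"
    by simp
  moreover have "xq_monom 5 7 = xq_monom 2 3 * xq_monom 3 4"
    by (simp add: xq_monom_mult)
  ultimately show ?thesis
    unfolding y_def [symmetric] y by (simp add: algebra_simps)
qed

text \<open>Under \<open>twist\<close>, a term x^m q^n G(xq^k) becomes x^m q^(n + m(m-1)/2)
  F(xq^(m+k)).\<close>

lemma twist_quad_gf_equation: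
  fixes h :: "rat fps fps"
  defines "h \<equiv> twist (weight_gf quad_weight quad_coeff)"
  shows "h = dilate 1 h + xq_monom 1 2 * dilate 2 h + xq_monom 2 5 * dilate 3 h
    + xq_monom 3 9 * dilate 4 h + xq_monom 2 4 * dilate 2 h + xq_monom 3 7 * dilate 3 h
    - xq_monom 5 17 * dilate 5 h"
proof -
  have choose: "(1 :: nat) choose 2 = 0" "(2 :: nat) choose 2 = 1" "(3 :: nat) choose 2 = 3" "(5 :: nat) choose 2 = 10"
    by (simp_all add: eval_nat_numeral)
  let ?g = "weight_gf quad_weight quad_coeff"
  have "h = twist (dilate 1 ?g + xq_monom 1 2 * dilate 1 ?g + xq_monom 2 4 * dilate 1 ?g
    + xq_monom 3 6 * dilate 1 ?g + xq_monom 2 3 * ?g + xq_monom 3 4 * ?g - xq_monom 5 7 * ?g)"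
    unfolding h_def by (rule arg_cong [OF quad_gf_equation])
  then show ?thesis
    unfolding twist_add twist_diff twist_xq_monom_mult twist_dilate dilate_dilate choose
      h_def [symmetric]
    by (simp add: eval_nat_numeral)
qed

lemma twist_quad_gf_nth_0: "twist (weight_gf quad_weight quad_coeff) $ 0 = 1"
proof -
  have "{a. quad_weight a = 0} = {(0, 0, 0, 0)}"
    by (auto simp: quad_weight_def)
  then show ?thesis
    by (simp add: weight_gf_nth quad_coeff_def q_pochhammer_def binomial_eq_0)
qed

section \<open>From the series F to the multisum\<close>

definition numerator :: "rat fps fps \<Rightarrow> rat fps fps" where
  "numerator f = f + xq_monom 1 1 * dilate 1 f + xq_monom 2 3 * dilate 2 f - xq_monom 3 7 * dilate 3 f"

definition quad_term :: "quad \<Rightarrow> rat fps fps" where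
  "quad_term a = xq_monom (quad_weight a) (quad_weight a choose 2) * fps_const (quad_coeff a)"

text \<open>Binomial exponents satisfy (M+r choose 2) = (M choose 2) + rM + (r choose 2). The term
  rM is a dilation by r; adding (r choose 2) = 0, 0, 1, 3 to the shifts 0, 1, 2, 4 gives the
  exponents 0, 1, 3, 7 of \<open>numerator\<close>.\<close>

lemma multisum_term_eq: "multisum_term a = numerator (quad_term a)"
proof -
  obtain i j k l where a: "a = (i, j, k, l)"
    by (cases a) auto
  define M where "M = i + 2 * j + 3 * k + 4 * l"
  define L where "L = 2 * l ^ 2 + 2 * i + 3 * j + 4 * k + 6 * l"
  define D :: "rat fps" where
    "D = inverse (q_pochhammer fps_X fps_X i * q_pochhammer (fps_X ^ 2) (fps_X ^ 2) j *
              q_pochhammer (fps_X ^ 3) (fps_X ^ 3) k * q_pochhammer (fps_X ^ 4) (fps_X ^ 4) l)"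
  have M: "M * (M - 1) div 2 = (M choose 2)" "(M + 1) * M div 2 = (M choose 2) + M"
    "(M + 2) * (M + 1) div 2 = (M choose 2) + 2 * M + 1"
    "(M + 3) * (M + 2) div 2 = (M choose 2) + 3 * M + 3"
    using choose_two [of M] choose_two [of "M + 1"] choose_two [of "M + 2"] choose_two [of "M + 3"]
    by (simp_all add: eval_nat_numeral)
  have dilate_const: "dilate r (fps_const c) = fps_const c" for r c
    by (simp add: fps_eq_iff [where 'a = "rat fps"])
  have coeff: "fps_const (quad_coeff a) = (-1) ^ l * xq_monom 0 L * fps_const D"
    by (simp add: quad_coeff_def a L_def D_def xq_monom_def fps_const_mult [symmetric] del: fps_const_mult)
      (simp flip: fps_const_power fps_const_neg)
  have "multisum_term a = (-1) ^ l *
        (xq_monom M ((M choose 2) + L)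
         + xq_monom (M + 1) ((M choose 2) + M + L + 1)
         + xq_monom (M + 2) ((M choose 2) + 2 * M + 1 + L + 2)
         - xq_monom (M + 3) ((M choose 2) + 3 * M + 3 + L + 4)) * fps_const D"
    unfolding multisum_term_def a prod.case Let_def M_def [symmetric] L_def [symmetric]
      D_def [symmetric] M by (rule refl)
  also have "\<dots> = numerator (quad_term a)"
  proof -
    have w: "quad_weight a = M"
      by (simp add: quad_weight_def a M_def)
    have shift: "xq_monom r s * dilate r (quad_term a) =
        (-1) ^ l * xq_monom (M + r) ((M choose 2) + r * M + L + s) * fps_const D" for r s
    proof -
      have "xq_monom (M + r) ((M choose 2) + r * M + L + s) =
          xq_monom r s * xq_monom M ((M choose 2) + r * M) * xq_monom 0 L"
        by (simp add: xq_monom_mult add_ac)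
      moreover have "dilate r (quad_term a) = xq_monom M ((M choose 2) + r * M) *
          ((-1) ^ l * xq_monom 0 L * fps_const D)"
        unfolding quad_term_def dilate_xq_monom_mult dilate_const w unfolding coeff ..
      ultimately show ?thesis
        by (simp only: mult_ac)
    qed
    have "numerator (quad_term a) = xq_monom 0 0 * dilate 0 (quad_term a) +
        xq_monom 1 1 * dilate 1 (quad_term a) + xq_monom 2 3 * dilate 2 (quad_term a)
        - xq_monom 3 7 * dilate 3 (quad_term a)"
      by (simp add: numerator_def dilate_0 xq_monom_def)
    then show ?thesis
      unfolding shift by (simp add: algebra_simps eval_nat_numeral)
  qed
  finally show ?thesis .
qed

text \<open>Coefficient m of the result depends only on the coefficients of \<open>f\<close> up to
  m, so \<open>numerator\<close> can be computed from truncated sums.\<close>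

lemma numerator_nth:
  "numerator f $ m = f $ m + (if m < 1 then 0 else fps_X * (fps_X ^ (m - 1) * f $ (m - 1)))
     + (if m < 2 then 0 else fps_X ^ 3 * (fps_X ^ (2 * (m - 2)) * f $ (m - 2)))
     - (if m < 3 then 0 else fps_X ^ 7 * (fps_X ^ (3 * (m - 3)) * f $ (m - 3)))"
  by (simp add: numerator_def xq_monom_mult_nth)

lemma numerator_sum: "numerator (\<Sum>a\<in>A. f a) = (\<Sum>a\<in>A. numerator (f a))"
proof (induction A rule: infinite_finite_induct)
  case (insert a A)
  have "numerator (f + g) = numerator f + numerator g" for f g
    by (simp add: numerator_def dilate_add algebra_simps)
  with insert show ?case
    by simp
qed (simp_all add: numerator_def fps_eq_iff [where 'a = "rat fps"] xq_monom_mult_nth)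

lemma quad_term_nth:
  "quad_term a $ m = (if quad_weight a = m then fps_X ^ (m choose 2) * quad_coeff a else 0)"
  by (auto simp: quad_term_def xq_monom_mult_nth simp del: fps_mult_right_const_nth)

lemma multisum_term_nth_eq_0:
  assumes "m < quad_weight a"
  shows "multisum_term a $ m = 0"
proof -
  have "quad_term a $ j = 0" if "j \<le> m" for j
    using that assms by (simp add: quad_term_nth)
  then show ?thesis
    by (simp add: multisum_term_eq numerator_nth)
qed

lemma finite_quad_weight_le: "finite {a. quad_weight a \<le> m}"
proof -
  have "{a. quad_weight a \<le> m} = (\<Union>i\<le>m. {a. quad_weight a = i})"
    by auto
  then show ?thesis
    by (simp add: finite_quad_weight)
qed

lemma multisum_support: "{a \<in> UNIV. multisum_term a $ m $ n \<noteq> 0} \<subseteq> {a. quad_weight a \<le> m}"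
  using multisum_term_nth_eq_0 by (force simp: not_le [symmetric])

lemma formally_summable_multisum: "formally_summable multisum_term UNIV"
  unfolding formally_summable_def
  using finite_subset [OF multisum_support finite_quad_weight_le] by blast

text \<open>For fixed m only the quadruples of weight at most m matter. On this finite set
  \<open>numerator\<close> commutes with the sum, and the truncated sum agrees with F in all
  coefficients up to m.\<close>

lemma formal_sum_multisum:
  "formal_sum multisum_term UNIV = numerator (twist (weight_gf quad_weight quad_coeff))"
proof (rule fps_ext)
  fix m
  let ?B = "{a. quad_weight a \<le> m}"
  have "formal_sum multisum_term UNIV $ m = (\<Sum>a\<in>?B. multisum_term a) $ m"
  proof (rule fps_ext)
    fix n
    show "formal_sum multisum_term UNIV $ m $ n = (\<Sum>a\<in>?B. multisum_term a) $ m $ n"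
      unfolding formal_sum_def fps_nth_Abs_fps fps_sum_nth
      by (rule sum.mono_neutral_left [OF finite_quad_weight_le multisum_support]) auto
  qed
  also have "\<dots> = numerator (\<Sum>a\<in>?B. quad_term a) $ m"
    by (simp add: numerator_sum multisum_term_eq)
  finally have eq: "formal_sum multisum_term UNIV $ m = numerator (\<Sum>a\<in>?B. quad_term a) $ m" .
  have "(\<Sum>a\<in>?B. quad_term a) $ j = twist (weight_gf quad_weight quad_coeff) $ j"
    if "j \<le> m" for j
  proof -
    have "(\<Sum>a\<in>?B. quad_term a $ j) = (\<Sum>a | quad_weight a = j. quad_term a $ j)"
      using that
      by (intro sum.mono_neutral_right finite_quad_weight_le) (auto simp: quad_term_nth)
    then show ?thesis
      by (simp add: fps_sum_nth weight_gf_nth quad_term_nth sum_distrib_left)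
  qed
  then have "numerator (\<Sum>a\<in>?B. quad_term a) $ m =
      numerator (twist (weight_gf quad_weight quad_coeff)) $ m"
    by (simp add: numerator_nth del: twist_nth)
  with eq show "formal_sum multisum_term UNIV $ m =
      numerator (twist (weight_gf quad_weight quad_coeff)) $ m"
    by simp
qed

section \<open>Comparison of the two sides\<close>

lemma twist_quad_gf_eq: "twist (weight_gf quad_weight quad_coeff) = dilate 1 (list_gf (avoiding 0))"
proof -
  define e where "e = list_gf (avoiding 0)"
  define h where "h = twist (weight_gf quad_weight quad_coeff)"
  define s :: "nat \<times> nat \<times> nat \<Rightarrow> rat fps fps" where
    "s = (\<lambda>(m, n, k). if m = 5 then -1 else 1)"
  \<comment> \<open>The triples (m, n, k) are the terms x^m q^n f(xq^k) of
    \<open>twist_quad_gf_equation\<close>; only the one with m = 5 has a negative sign in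
    \<open>s\<close>.\<close>
  define R :: "(nat \<times> nat \<times> nat) set" where
    "R = {(1, 2, 2), (2, 5, 3), (3, 9, 4), (2, 4, 2), (3, 7, 3), (5, 17, 5)}"
  let ?F = "\<lambda>f. dilate 1 f + (\<Sum>(m, n, k)\<in>R. s (m, n, k) * (xq_monom m n * dilate k f))"
  have F: "?F f = dilate 1 f + xq_monom 1 2 * dilate 2 f + xq_monom 2 5 * dilate 3 f
    + xq_monom 3 9 * dilate 4 f + xq_monom 2 4 * dilate 2 f + xq_monom 3 7 * dilate 3 f
    - xq_monom 5 17 * dilate 5 f" for f
    by (simp add: R_def s_def algebra_simps)
  have h: "h = ?F h"
    unfolding F h_def by (rule twist_quad_gf_equation)
  \<comment> \<open>Replacing x by xq multiplies x^m q^n by q^m, which matches the exponents in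
    \<open>R\<close>.\<close>
  have "dilate 1 e = dilate 1 (dilate 1 e + xq_monom 1 1 * dilate 2 e + xq_monom 2 3 * dilate 3 e
    + xq_monom 3 6 * dilate 4 e + xq_monom 3 4 * dilate 3 e + xq_monom 2 2 * dilate 2 e
    - xq_monom 5 12 * dilate 5 e)"
    unfolding e_def by (rule arg_cong [OF list_gf_avoiding_equation])
  also have "\<dots> = ?F (dilate 1 e)"
    unfolding F
    by (simp add: dilate_add dilate_diff dilate_xq_monom_mult dilate_dilate eval_nat_numeral)
  finally have e: "dilate 1 e = ?F (dilate 1 e)" .
  have "h - dilate 1 e = 0"
  proof (rule dilation_equation_unique)
    have "h - dilate 1 e = ?F h - ?F (dilate 1 e)"
      using h e by (rule arg_cong2)
    also have "\<dots> = ?F (h - dilate 1 e)"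
      unfolding F by (simp add: dilate_diff algebra_simps)
    finally show "h - dilate 1 e = ?F (h - dilate 1 e)" .
    show "0 < m" if "(m, n, k) \<in> R" for m n k
      using that by (auto simp: R_def)
    show "(h - dilate 1 e) $ 0 = 0"
      using twist_quad_gf_nth_0 by (simp add: h_def e_def list_gf_avoiding_nth_0 del: twist_nth)
  qed
  then show ?thesis
    by (simp add: h_def e_def)
qed

theorem mainTheorem12:
  shows "formally_summable (\<lambda>\<pi>. xq_monom (length \<pi>) (sum_list \<pi>)) restricted_partitions
       \<and> formally_summable multisum_term UNIV
       \<and> formal_sum (\<lambda>\<pi>. xq_monom (length \<pi>) (sum_list \<pi>)) restricted_partitions
         = formal_sum multisum_term UNIV"
proof (intro conjI)
  show "list_gf restricted_partitions = formal_sum multisum_term UNIV"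
    \<comment> \<open>With F(x) = E(xq), the four terms of \<open>numerator\<close> are those of
      \<open>list_gf_restricted_partitions\<close>.\<close>
    unfolding formal_sum_multisum twist_quad_gf_eq numerator_def list_gf_restricted_partitions
      dilate_dilate
    by (simp add: eval_nat_numeral)
qed (rule formally_summable_list_weight formally_summable_multisum)+

end
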